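(* Let ${\bf b}_n={\bf b}_n(y;p,q)=\sum_{\pi \in \mathcal{B}_n}p^{\tau(\pi)}q^{\sigma(\pi)}y^{\mathrm{cap}(\pi)}$ for $n\geq 1$, with ${\bf b}_0=1$, and let $F(x,y;p,q)=\sum_{n\geq 0}{\bf b}_n(y;p,q)x^n$. Then, as formal power series in $x$ with coefficients polynomial in $y,p,q$, $$F(x,y;p,q)=\frac{1}{1-px}+\sum_{n\geq1}\frac{q^{n^2}x^{2n}}{(1-px)(1-pq^nx)\prod_{j=1}^{n-1}(1-pq^jxy)}.$$
   Context: A composition of $n$ is a finite sequence of positive integers (parts) with sum $n$; $\mathcal{B}_n$ denotes the set of compositions of $n$ with all parts in $\{1,2\}$. For $\pi=\pi_1\cdots\pi_m\in\mathcal{B}_n$: - The capacity $\mathrm{cap}(\pi)$ is the number of water cells of the bargraph of $\pi$ (the unit cells outside the bargraph, whose $i$-th column has height $\pi_i$, that would hold water). For $\pi\in\mathcal{B}_n$ this equals the number of indices $i$ with $\pi_i=1$ such that $\pi_a=2$ for some $a<i$ and $\pi_b=2$ for some $b>i$. - $\tau(\pi)$ is the number of parts equal to $1$ in $\pi$. - If $1\le i_1<\cdots<i_r\le m$ are the indices $j$ with $\pi_j=2$, then $\sigma(\pi)=r+\sum_{j=1}^r\sum_{k=1}^{i_j-1}\pi_k$. *)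

theory Defs
  imports "HOL-Computational_Algebra.Formal_Power_Series"
begin

text \<open>
  Sequences are lists and hence indexed from 0: the part written pi_i with 1 <= i <= m
  is the list entry with index i - 1.
\<close>

definition compositions :: "nat \<Rightarrow> nat list set" where
  "compositions n = {\<pi>. (\<forall>k\<in>set \<pi>. 0 < k) \<and> sum_list \<pi> = n}"

definition compositions12 :: "nat \<Rightarrow> nat list set" where
  "compositions12 n = {\<pi> \<in> compositions n. set \<pi> \<subseteq> {1, 2}}"

text \<open>
  The pair (i, h) is the unit cell at height h (heights start from 1) of column i. It lies
  outside the bargraph iff h exceeds the height of column i; it then holds water iff the
  bargraph has, on either side of it, a column reaching at least height h.
\<close>

definition water_cells :: "nat list \<Rightarrow> (nat \<times> nat) set" where
  "water_cells \<pi> = {(i, h). i < length \<pi> \<and> \<pi> ! i < h \<and>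
     (\<exists>a<i. h \<le> \<pi> ! a) \<and> (\<exists>b<length \<pi>. i < b \<and> h \<le> \<pi> ! b)}"

definition cap :: "nat list \<Rightarrow> nat" where
  "cap \<pi> = card (water_cells \<pi>)"

definition tau :: "nat list \<Rightarrow> nat" where
  "tau \<pi> = card {i. i < length \<pi> \<and> \<pi> ! i = 1}"

definition twos :: "nat list \<Rightarrow> nat set" where
  "twos \<pi> = {j. j < length \<pi> \<and> \<pi> ! j = 2}"

definition sigma :: "nat list \<Rightarrow> nat" where
  "sigma \<pi> = card (twos \<pi>) + (\<Sum>j\<in>twos \<pi>. \<Sum>k<j. \<pi> ! k)"

text \<open>
  The variables y, p, q range over an arbitrary commutative ring; taking that ring to be a
  polynomial ring and y, p, q its generators gives the polynomials in indeterminates y, p, q.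
\<close>

definition b_poly :: "nat \<Rightarrow> 'a::comm_ring_1 \<Rightarrow> 'a \<Rightarrow> 'a \<Rightarrow> 'a" where
  "b_poly n y p q = (if n = 0 then 1 else \<Sum>\<pi>\<in>compositions12 n. p ^ tau \<pi> * q ^ sigma \<pi> * y ^ cap \<pi>)"

definition F_series :: "'a::comm_ring_1 \<Rightarrow> 'a \<Rightarrow> 'a \<Rightarrow> 'a fps" where
  "F_series y p q = Abs_fps (\<lambda>n. b_poly n y p q)"

text \<open>
  The library's \<open>inverse\<close> on power series needs an inverse on coefficients. A series with
  constant term 1 is invertible over every commutative ring, with the inverse given here.
\<close>

definition fps_recip :: "'a::comm_ring_1 fps \<Rightarrow> 'a fps" where
  "fps_recip f = fps_right_inverse f 1"

lemma fps_recip: "fps_nth f 0 = 1 \<Longrightarrow> f * fps_recip f = 1"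
  unfolding fps_recip_def by (rule fps_right_inverse) simp

lemma finite_compositions12: "finite (compositions12 n)"
proof (rule finite_subset)
  have "length \<pi> \<le> sum_list \<pi>" if "\<forall>k\<in>set \<pi>. 0 < k" for \<pi> :: "nat list"
    using that by (induction \<pi>) auto
  then show "compositions12 n \<subseteq> {\<pi>. set \<pi> \<subseteq> {1, 2} \<and> length \<pi> \<le> n}"
    unfolding compositions12_def compositions_def by auto
  show "finite {\<pi> :: nat list. set \<pi> \<subseteq> {1, 2} \<and> length \<pi> \<le> n}"
    by (rule finite_lists_length_le) simp
qed

lemma cap_compositions12:
  assumes "\<pi> \<in> compositions12 n"
  shows "cap \<pi> = card {i. i < length \<pi> \<and> \<pi> ! i = 1 \<and>
    (\<exists>a<i. \<pi> ! a = 2) \<and> (\<exists>b<length \<pi>. i < b \<and> \<pi> ! b = 2)}" (is "_ = card ?I")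
proof -
  have *: "\<pi> ! i = 1 \<or> \<pi> ! i = 2" if "i < length \<pi>" for i
    using assms that nth_mem[OF that] unfolding compositions12_def by blast
  have "water_cells \<pi> = (\<lambda>i. (i, 2 :: nat)) ` ?I"
  proof (intro set_eqI iffI)
    fix c assume "c \<in> water_cells \<pi>"
    then obtain i h a b' where c: "c = (i, h)" "i < length \<pi>" "\<pi> ! i < h" "a < i" "h \<le> \<pi> ! a"
      "b' < length \<pi>" "i < b'" "h \<le> \<pi> ! b'"
      unfolding water_cells_def by blast
    have "\<pi> ! i = 1" "h = 2" "\<pi> ! a = 2" "\<pi> ! b' = 2"
      using *[of i] *[of a] *[of b'] c by auto
    with c show "c \<in> (\<lambda>i. (i, 2 :: nat)) ` ?I" by blast
  next
    fix c assume "c \<in> (\<lambda>i. (i, 2 :: nat)) ` ?I"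
    then show "c \<in> water_cells \<pi>" unfolding water_cells_def by force
  qed
  then show ?thesis unfolding cap_def by (simp add: card_image inj_on_def)
qed

end

theory Submission
  imports Defs
begin

text \<open>
  Write a composition with \<open>k\<close> parts 2 as \<open>1^{a_0} 2 1^{a_1} 2 \<dots> 2
  1^{a_k}\<close>. The \<open>j\<close>-th part 2 contributes \<open>1 + 2(j - 1) + a_0 + \<dots> +
  a_{j-1}\<close> to \<open>\<sigma>\<close>, so in total \<open>\<sigma> = k\<^sup>2 + \<Sum>i. (k - i)
  a_i\<close>, while for \<open>k \<ge> 1\<close> the capacity is \<open>a_1 + \<dots> + a_{k-1}\<close>.
  Summing freely over the \<open>a_i\<close> gives, for \<open>k \<ge> 1\<close>, \<open>q^{k^2}
  x^{2k}\<close> times a product of geometric series: the factor \<open>1/(1 - px)\<close> comes from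
  \<open>a_k\<close>, the factor \<open>1/(1 - p q^k x)\<close> from \<open>a_0\<close>, and the factor
  \<open>1/(1 - p q^j x y)\<close> from \<open>a_{k-j}\<close> for \<open>1 \<le> j < k\<close>. For
  \<open>k = 0\<close> only the powers of 1 remain, with the series \<open>1/(1 - px)\<close>.

  Instead of parametrising by the exponents \<open>a_i\<close>, the proof builds a composition from the
  right, prepending one part at a time (\<open>gf_rec\<close>). With \<open>k\<close> fixed, prepending a
  1 multiplies the weight by a constant, and so the block of 1s in front of the first 2 yields one
  geometric series; what follows that 2 has \<open>k - 1\<close> parts 2, so \<open>k\<close> goes down
  by 1. The capacity is not compatible with this recursion by itself, since a 1 holds water only if there
  is a 2 on both sides. It is therefore computed alongside \<open>right_cap\<close>, the capacity that
  the composition acquires once a 2 stands in front of it: the denominators of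
  \<open>gf_right_weight\<close> accumulate the factors \<open>1 - p q^j x y\<close>, and in
  \<open>gf_cap_weight\<close> only the block of 1s in front of the first 2 loses its \<open>y\<close>.
\<close>

unbundle fps_syntax

section \<open>Statistics of a composition under prepending a part\<close>

lemma card_index_Cons:
  "card {i. i < length (x # xs) \<and> P i} =
     (if P 0 then 1 else 0) + card {i. i < length xs \<and> P (Suc i)}"
proof -
  have "{i. i < length (x # xs) \<and> P i} =
    (if P 0 then {0} else {}) \<union> Suc ` {i. i < length xs \<and> P (Suc i)}"
    by (auto simp: image_iff less_Suc_eq_0_disj)
  then show ?thesis
    by (simp add: card_image card_insert_if)
qed

lemma tau_Cons: "tau (x # \<pi>) = (if x = 1 then 1 else 0) + tau \<pi>"
  unfolding tau_def by (subst card_index_Cons) simp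

lemma finite_twos: "finite (twos \<pi>)"
  unfolding twos_def by simp

lemma twos_Cons: "twos (x # \<pi>) = (if x = 2 then {0} else {}) \<union> Suc ` twos \<pi>"
  unfolding twos_def by (auto simp: image_iff less_Suc_eq_0_disj)

lemma card_twos_Cons: "card (twos (x # \<pi>)) = (if x = 2 then 1 else 0) + card (twos \<pi>)"
  unfolding twos_Cons by (simp add: card_image card_insert_if finite_twos)

text \<open>A part in front raises the sum of the preceding parts for every 2 that follows it.\<close>

lemma sigma_Cons:
  "sigma (x # \<pi>) = (if x = 2 then 1 else 0) + sigma \<pi> + x * card (twos \<pi>)"
proof -
  have "(\<Sum>j\<in>twos (x # \<pi>). \<Sum>k<j. (x # \<pi>) ! k) =
      (\<Sum>j\<in>Suc ` twos \<pi>. \<Sum>k<j. (x # \<pi>) ! k)"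
    unfolding twos_Cons by (rule sum.mono_neutral_right) (auto simp: finite_twos)
  also have "\<dots> = (\<Sum>j\<in>twos \<pi>. x + (\<Sum>k<j. \<pi> ! k))"
    by (simp add: sum.reindex sum.lessThan_Suc_shift del: sum.lessThan_Suc)
  finally show ?thesis
    by (simp add: sigma_def card_twos_Cons sum.distrib)
qed

definition right_cap :: "nat list \<Rightarrow> nat" where
  "right_cap \<pi> = card {i. i < length \<pi> \<and> \<pi> ! i = 1 \<and> (\<exists>b<length \<pi>. i < b \<and> \<pi> ! b = 2)}"

lemma right_cap_Cons:
  "right_cap (x # \<pi>) = (if x = 1 \<and> twos \<pi> \<noteq> {} then 1 else 0) + right_cap \<pi>"
  unfolding right_cap_def by (subst card_index_Cons) (auto simp: twos_def Ex_less_Suc2 Suc_less_eq2)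

text \<open>
  The first column never holds water. A 1 in front is no wall for any later column, whereas
  a 2 in front is a left wall for every later 1.
\<close>

lemma cap_Cons:
  assumes "x # \<pi> \<in> compositions12 n"
  shows "cap (x # \<pi>) = (if x = 2 then right_cap \<pi> else cap \<pi>)"
proof -
  have x: "x = 1 \<or> x = 2" and "\<pi> \<in> compositions12 (sum_list \<pi>)"
    using assms by (auto simp: compositions12_def compositions_def)
  from this(2) show ?thesis
    using x by (subst cap_compositions12[OF assms], subst card_index_Cons)
      (auto simp: cap_compositions12 right_cap_def Ex_less_Suc2)
qed

section \<open>Generating functions of compositions with a given number of parts 2\<close>

definition comps_with_twos :: "nat \<Rightarrow> nat \<Rightarrow> nat list set" where
  "comps_with_twos n k = {\<pi> \<in> compositions12 n. card (twos \<pi>) = k}"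

lemma finite_comps_with_twos: "finite (comps_with_twos n k)"
  unfolding comps_with_twos_def using finite_compositions12 by simp

lemma Nil_comps_with_twos: "[] \<in> comps_with_twos n k \<longleftrightarrow> n = 0 \<and> k = 0"
  by (auto simp: comps_with_twos_def compositions12_def compositions_def twos_def)

lemma Cons_comps_with_twos:
  "x # \<pi> \<in> comps_with_twos n k \<longleftrightarrow>
     x = 1 \<and> 1 \<le> n \<and> \<pi> \<in> comps_with_twos (n - 1) k \<or>
     x = 2 \<and> 2 \<le> n \<and> 1 \<le> k \<and> \<pi> \<in> comps_with_twos (n - 2) (k - 1)"
  unfolding comps_with_twos_def compositions12_def compositions_def mem_Collect_eq card_twos_Cons
  by auto

definition gf :: "(nat list \<Rightarrow> 'a::comm_ring_1) \<Rightarrow> nat \<Rightarrow> 'a fps" where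
  "gf w k = Abs_fps (\<lambda>n. \<Sum>\<pi>\<in>comps_with_twos n k. w \<pi>)"

lemma gf_rec:
  "gf w k = (if k = 0 then fps_const (w []) else 0) + fps_X * gf (\<lambda>\<pi>. w (1 # \<pi>)) k
     + (if k = 0 then 0 else fps_X\<^sup>2 * gf (\<lambda>\<pi>. w (2 # \<pi>)) (k - 1))"
proof (rule fps_ext)
  fix n :: nat
  let ?A = "if n = 0 \<and> k = 0 then {[]} else {} :: nat list set"
  let ?B = "if 1 \<le> n then Cons 1 ` comps_with_twos (n - 1) k else {}"
  let ?C = "if 2 \<le> n \<and> 1 \<le> k then Cons 2 ` comps_with_twos (n - 2) (k - 1) else {}"
  have split: "comps_with_twos n k = (?A \<union> ?B) \<union> ?C"
  proof (rule set_eqI)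
    fix \<pi>
    show "\<pi> \<in> comps_with_twos n k \<longleftrightarrow> \<pi> \<in> (?A \<union> ?B) \<union> ?C"
      by (cases \<pi>) (auto simp: Nil_comps_with_twos Cons_comps_with_twos)
  qed
  have fin: "finite ?A" "finite ?B" "finite ?C"
    using finite_comps_with_twos by auto
  have disj: "?A \<inter> ?B = {}" "(?A \<union> ?B) \<inter> ?C = {}"
    by auto
  have "gf w k $ n = sum w ((?A \<union> ?B) \<union> ?C)"
    unfolding gf_def fps_nth_Abs_fps split ..
  also have "\<dots> = sum w ?A + sum w ?B + sum w ?C"
    using fin disj by (simp only: sum.union_disjoint finite_Un)
  finally show "gf w k $ n = ((if k = 0 then fps_const (w []) else 0)
      + fps_X * gf (\<lambda>\<pi>. w (1 # \<pi>)) k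
      + (if k = 0 then 0 else fps_X\<^sup>2 * gf (\<lambda>\<pi>. w (2 # \<pi>)) (k - 1))) $ n"
    by (auto simp: sum.reindex gf_def fps_X_power_mult_nth)
qed

lemma gf_scale:
  assumes "\<And>n \<pi>. \<pi> \<in> comps_with_twos n k \<Longrightarrow> w' \<pi> = c * w \<pi>"
  shows "gf w' k = fps_const c * gf w k"
  by (rule fps_ext) (simp add: gf_def assms sum_distrib_left)

text \<open>
  Compositions without parts 2 are powers of 1. For \<open>k > 0\<close>, a composition consists of a
  block of 1s, then the first 2, then the rest; if every 1 of the block contributes the same
  factor \<open>a\<close>, the block becomes the geometric series \<open>1/(1 - ax)\<close>.
\<close>

lemma gf_no_twos:
  assumes "w [] = 1" and "\<And>n \<pi>. \<pi> \<in> comps_with_twos n 0 \<Longrightarrow> w (1 # \<pi>) = a * w \<pi>"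
  shows "(1 - fps_const a * fps_X) * gf w 0 = 1"
proof -
  have "gf w 0 = 1 + fps_X * (fps_const a * gf w 0)"
    by (subst gf_rec) (use assms in \<open>simp add: gf_scale[of 0 _ a w]\<close>)
  then show ?thesis
    by (simp add: algebra_simps)
qed

lemma gf_first_two:
  assumes "0 < k"
    and "\<And>n \<pi>. \<pi> \<in> comps_with_twos n k \<Longrightarrow> w (1 # \<pi>) = a * w \<pi>"
    and "\<And>n \<pi>. \<pi> \<in> comps_with_twos n (k - 1) \<Longrightarrow> w (2 # \<pi>) = b * v \<pi>"
  shows "(1 - fps_const a * fps_X) * gf w k = fps_const b * fps_X\<^sup>2 * gf v (k - 1)"
proof -
  have "gf w k = fps_X * (fps_const a * gf w k) + fps_X\<^sup>2 * (fps_const b * gf v (k - 1))"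
    by (subst gf_rec) (simp only: gf_scale[of k _ a w, OF assms(2)] gf_scale[of "k - 1" _ b v, OF assms(3)]
        gr_implies_not0[OF assms(1)] if_False add_0_left)
  then show ?thesis
    by (simp add: algebra_simps)
qed

section \<open>Closed forms\<close>

definition cap_weight :: "'a::comm_ring_1 \<Rightarrow> 'a \<Rightarrow> 'a \<Rightarrow> nat list \<Rightarrow> 'a" where
  "cap_weight y p q \<pi> = p ^ tau \<pi> * q ^ sigma \<pi> * y ^ cap \<pi>"

definition right_weight :: "'a::comm_ring_1 \<Rightarrow> 'a \<Rightarrow> 'a \<Rightarrow> nat list \<Rightarrow> 'a" where
  "right_weight y p q \<pi> = p ^ tau \<pi> * q ^ sigma \<pi> * y ^ right_cap \<pi>"

lemma weight_Nil: "cap_weight y p q [] = 1" "right_weight y p q [] = 1"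
  by (simp_all add: cap_weight_def right_weight_def tau_def sigma_def twos_def right_cap_def
      cap_def water_cells_def)

lemma cap_weight_Cons_1:
  assumes "\<pi> \<in> comps_with_twos n k"
  shows "cap_weight y p q (1 # \<pi>) = p * q ^ k * cap_weight y p q \<pi>"
proof -
  have "1 # \<pi> \<in> compositions12 (Suc n)" and k: "card (twos \<pi>) = k"
    using assms by (auto simp: comps_with_twos_def compositions12_def compositions_def)
  from cap_Cons[OF this(1)] show ?thesis
    by (simp add: cap_weight_def tau_Cons sigma_Cons k power_add mult_ac)
qed

lemma cap_weight_Cons_2:
  assumes "\<pi> \<in> comps_with_twos n k"
  shows "cap_weight y p q (2 # \<pi>) = q ^ (2 * k + 1) * right_weight y p q \<pi>"
proof -
  have "2 # \<pi> \<in> compositions12 (n + 2)" and k: "card (twos \<pi>) = k"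
    using assms by (auto simp: comps_with_twos_def compositions12_def compositions_def)
  from cap_Cons[OF this(1)] show ?thesis
    by (simp add: cap_weight_def right_weight_def tau_Cons sigma_Cons k power_add mult_ac)
qed

lemma right_weight_Cons_1:
  assumes "\<pi> \<in> comps_with_twos n k"
  shows "right_weight y p q (1 # \<pi>) = p * q ^ k * (if k = 0 then 1 else y) * right_weight y p q \<pi>"
proof -
  have "card (twos \<pi>) = k" "twos \<pi> = {} \<longleftrightarrow> k = 0"
    using assms finite_twos[of \<pi>] by (auto simp: comps_with_twos_def)
  then show ?thesis
    by (simp add: right_weight_def tau_Cons sigma_Cons right_cap_Cons power_add mult_ac)
qed

lemma right_weight_Cons_2:
  assumes "\<pi> \<in> comps_with_twos n k"
  shows "right_weight y p q (2 # \<pi>) = q ^ (2 * k + 1) * right_weight y p q \<pi>"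
  using assms
  by (simp add: comps_with_twos_def right_weight_def tau_Cons sigma_Cons right_cap_Cons power_add mult_ac)

text \<open>
  Prepending a 2 to a composition with \<open>k\<close> parts 2 contributes \<open>q^{2k+1}\<close>, and these odd
  exponents add up to the square on the right. With a 2 assumed in front, every 1 that has \<open>j\<close>
  parts 2 to its right holds water unless \<open>j = 0\<close>; hence \<open>y\<close> occurs in all factors but the first.
\<close>

lemma gf_right_weight:
  "(1 - fps_const p * fps_X) * (\<Prod>j\<in>{1..k}. 1 - fps_const (p * q ^ j * y) * fps_X)
     * gf (right_weight y p q) k = fps_const (q ^ k\<^sup>2) * fps_X ^ (2 * k)"
proof (induction k)
  case 0
  show ?case
    using gf_no_twos[of "right_weight y p q" p] right_weight_Cons_1[of _ _ 0 y p q]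
    by (simp add: weight_Nil)
next
  case (Suc k)
  let ?R = "gf (right_weight y p q)"
  let ?D = "(1 - fps_const p * fps_X) * (\<Prod>j\<in>{1..k}. 1 - fps_const (p * q ^ j * y) * fps_X)"
  let ?L = "1 - fps_const (p * q ^ Suc k * y) * fps_X"
  have step: "?L * ?R (Suc k) = fps_const (q ^ (2 * k + 1)) * fps_X\<^sup>2 * ?R k"
    using gf_first_two[of "Suc k" "right_weight y p q" "p * q ^ Suc k * y" "q ^ (2 * k + 1)"
        "right_weight y p q"]
      right_weight_Cons_1[of _ _ "Suc k" y p q] right_weight_Cons_2[of _ _ k y p q]
    by simp
  have "(1 - fps_const p * fps_X) * (\<Prod>j\<in>{1..Suc k}. 1 - fps_const (p * q ^ j * y) * fps_X)
      * ?R (Suc k) = ?D * (?L * ?R (Suc k))"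
    by (simp add: prod.nat_ivl_Suc' mult_ac)
  also have "\<dots> = fps_const (q ^ (2 * k + 1)) * fps_X\<^sup>2 * (?D * ?R k)"
    unfolding step by (simp only: mult_ac)
  also have "\<dots> = fps_const (q ^ (2 * k + 1) * q ^ k\<^sup>2) * (fps_X\<^sup>2 * fps_X ^ (2 * k))"
    unfolding Suc.IH by (simp only: fps_const_mult [symmetric] mult_ac)
  also have "q ^ (2 * k + 1) * q ^ k\<^sup>2 = q ^ (Suc k)\<^sup>2"
    unfolding power_add [symmetric] by (rule arg_cong[of _ _ "power q"]) (simp add: power2_eq_square)
  also have "fps_X\<^sup>2 * fps_X ^ (2 * k) = (fps_X ^ (2 * Suc k) :: 'a fps)"
    by (simp only: power_add [symmetric]) simp
  finally show ?case .
qed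

lemma fps_recip_unique:
  assumes "f $ 0 = 1" and "f * g = h"
  shows "g = h * fps_recip f"
proof -
  have "h * fps_recip f = g * (f * fps_recip f)"
    unfolding assms(2) [symmetric] by (simp only: mult_ac)
  then show ?thesis
    using fps_recip[OF assms(1)] by simp
qed

lemma fps_nth_prod_0: "(\<Prod>j\<in>A. f j) $ 0 = (\<Prod>j\<in>A. f j $ 0)"
  by (induction A rule: infinite_finite_induct) simp_all

lemma gf_cap_weight_0: "gf (cap_weight y p q) 0 = fps_recip (1 - fps_const p * fps_X)"
  using fps_recip_unique[OF _ gf_no_twos[of "cap_weight y p q" p]]
    cap_weight_Cons_1[of _ _ 0 y p q]
  by (simp add: weight_Nil)

text \<open>
  Behind the first 2 the capacity is \<open>right_cap\<close>, so only the factor of the leading block is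
  new: its 1s have \<open>k\<close> parts 2 to their right and hold no water.
\<close>

lemma gf_cap_weight:
  assumes "0 < k"
  shows "gf (cap_weight y p q) k = fps_const (q ^ k\<^sup>2) * fps_X ^ (2 * k) *
    fps_recip ((1 - fps_const p * fps_X) * (1 - fps_const (p * q ^ k) * fps_X) *
      (\<Prod>j\<in>{1..k - 1}. 1 - fps_const (p * q ^ j * y) * fps_X))"
proof (rule fps_recip_unique)
  let ?D = "(1 - fps_const p * fps_X) * (\<Prod>j\<in>{1..k - 1}. 1 - fps_const (p * q ^ j * y) * fps_X)"
  let ?L = "1 - fps_const (p * q ^ k) * fps_X"
  from assms have exp: "2 * (k - 1) + 1 + (k - 1)\<^sup>2 = k\<^sup>2" "2 + 2 * (k - 1) = 2 * k"
    by (cases k; simp add: power2_eq_square)+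
  have step: "?L * gf (cap_weight y p q) k =
      fps_const (q ^ (2 * (k - 1) + 1)) * fps_X\<^sup>2 * gf (right_weight y p q) (k - 1)"
    by (rule gf_first_two[OF assms cap_weight_Cons_1 cap_weight_Cons_2])
  have "(1 - fps_const p * fps_X) * (1 - fps_const (p * q ^ k) * fps_X) *
      (\<Prod>j\<in>{1..k - 1}. 1 - fps_const (p * q ^ j * y) * fps_X) * gf (cap_weight y p q) k =
      ?D * (?L * gf (cap_weight y p q) k)"
    by (simp only: mult_ac)
  also have "\<dots> = fps_const (q ^ (2 * (k - 1) + 1)) * fps_X\<^sup>2 *
      (?D * gf (right_weight y p q) (k - 1))"
    unfolding step by (simp only: mult_ac)
  also have "\<dots> = fps_const (q ^ (2 * (k - 1) + 1) * q ^ (k - 1)\<^sup>2) *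
      (fps_X\<^sup>2 * fps_X ^ (2 * (k - 1)))"
    unfolding gf_right_weight by (simp only: fps_const_mult [symmetric] mult_ac)
  also have "\<dots> = fps_const (q ^ k\<^sup>2) * fps_X ^ (2 * k)"
    by (simp only: power_add [symmetric] exp)
  finally show "(1 - fps_const p * fps_X) * (1 - fps_const (p * q ^ k) * fps_X) *
      (\<Prod>j\<in>{1..k - 1}. 1 - fps_const (p * q ^ j * y) * fps_X) * gf (cap_weight y p q) k =
      fps_const (q ^ k\<^sup>2) * fps_X ^ (2 * k)" .
qed (simp add: fps_nth_prod_0)

section \<open>Summation over the number of parts 2\<close>

lemma card_twos_le:
  assumes "\<pi> \<in> compositions12 n"
  shows "card (twos \<pi>) \<le> n"
proof -
  have "card (twos \<pi>) \<le> sum_list \<pi>"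
    by (induction \<pi>) (auto simp: card_twos_Cons, simp add: twos_def)
  then show ?thesis
    using assms by (simp add: compositions12_def compositions_def)
qed

text \<open>
  A composition of \<open>n\<close> has at most \<open>n\<close> parts 2, so the coefficient of \<open>x^n\<close> in the partial
  sums is constant from some point on; this is convergence of formal power series.
\<close>

lemma gf_sums: "gf w sums Abs_fps (\<lambda>n. \<Sum>\<pi>\<in>compositions12 n. w \<pi>)"
  unfolding sums_def
proof (rule tendsto_fpsI)
  fix n
  have "(\<Sum>k<N. gf w k) $ n = Abs_fps (\<lambda>n. \<Sum>\<pi>\<in>compositions12 n. w \<pi>) $ n" if "n < N" for N
  proof -
    have "(\<Sum>k<N. gf w k) $ n = (\<Sum>k<N. \<Sum>\<pi>\<in>{\<pi> \<in> compositions12 n. card (twos \<pi>) = k}. w \<pi>)"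
      by (simp add: fps_sum_nth gf_def comps_with_twos_def)
    also have "\<dots> = (\<Sum>\<pi>\<in>compositions12 n. w \<pi>)"
      using that by (intro sum.group) (auto simp: finite_compositions12 dest: card_twos_le)
    finally show ?thesis
      by simp
  qed
  then show "\<forall>\<^sub>F N in sequentially.
      (\<Sum>k<N. gf w k) $ n = Abs_fps (\<lambda>n. \<Sum>\<pi>\<in>compositions12 n. w \<pi>) $ n"
    unfolding eventually_at_top_linorder by (metis Suc_le_eq)
qed

lemma fps_sums_Suc:
  fixes f :: "nat \<Rightarrow> 'a::comm_ring_1 fps"
  assumes "f sums S"
  shows "(\<lambda>n. f (Suc n)) sums (S - f 0)"
  unfolding sums_def
proof (rule tendsto_fpsI)
  fix n
  have "\<forall>\<^sub>F N in sequentially. (\<Sum>k<N. f k) $ n = S $ n"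
    using assms unfolding sums_def tendsto_fps_iff by blast
  then have "\<forall>\<^sub>F N in sequentially. (\<Sum>k<Suc N. f k) $ n = S $ n"
    by (rule eventually_sequentially_Suc[THEN iffD2])
  then show "\<forall>\<^sub>F N in sequentially. (\<Sum>k<N. f (Suc k)) $ n = (S - f 0) $ n"
    by eventually_elim (simp add: sum.lessThan_Suc_shift fps_sum_nth eq_diff_eq add.commute del: sum.lessThan_Suc)
qed

lemma F_series_eq: "F_series y p q = Abs_fps (\<lambda>n. \<Sum>\<pi>\<in>compositions12 n. cap_weight y p q \<pi>)"
proof -
  have "compositions12 0 = {[]}"
  proof (rule set_eqI)
    show "\<pi> \<in> compositions12 0 \<longleftrightarrow> \<pi> \<in> {[]}" for \<pi>
      by (cases \<pi>) (auto simp: compositions12_def compositions_def)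
  qed
  then have "b_poly n y p q = (\<Sum>\<pi>\<in>compositions12 n. cap_weight y p q \<pi>)" for n
    by (cases "n = 0") (simp_all add: b_poly_def weight_Nil, simp add: cap_weight_def)
  then show ?thesis
    by (simp add: F_series_def)
qed

theorem theorem6:
  fixes y p q :: "'a::comm_ring_1"
  shows "let T = (\<lambda>n::nat. fps_const (q ^ n\<^sup>2) * fps_X ^ (2 * n) *
      fps_recip ((1 - fps_const p * fps_X) * (1 - fps_const (p * q ^ n) * fps_X) *
        (\<Prod>j\<in>{1..n - 1}. 1 - fps_const (p * q ^ j * y) * fps_X)))
    in summable (\<lambda>n. T (Suc n)) \<and>
       F_series y p q = fps_recip (1 - fps_const p * fps_X) + (\<Sum>n. T (Suc n))"
proof -
  have "(\<lambda>n. gf (cap_weight y p q) (Suc n)) sums (F_series y p q - gf (cap_weight y p q) 0)"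
    unfolding F_series_eq by (rule fps_sums_Suc[OF gf_sums])
  then show ?thesis
    unfolding Let_def gf_cap_weight[OF zero_less_Suc] gf_cap_weight_0
    by (simp only: sums_iff) simp
qed

end
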